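(* For every graph $H$ (connected, with at least three nodes, of constant size) that is not a complete multipartite graph and every $r \geq 1$, the $r$-round bandwidth complexity of $\textsc{MemList}(H)$ under edge insertions is $\Omega(n^2/r)$.
   Context: A graph is complete multipartite if its node set can be partitioned into independent sets such that two nodes are adjacent iff they lie in different parts. Dynamic network model: a sequence of graphs $G^0, G^1, \ldots$ on $n$ nodes, each obtained from the previous by at most one edge insertion; nodes have distinct IDs from $[n]$, know their neighbors' IDs and initially the whole of $G^0$; communication is synchronous, each round the change happens first, then each node sends a $B$-bit message to each neighbor; nodes detect changes only via their neighbor lists; algorithms are deterministic. An $r$-round algorithm works under the promise that each change at round $i$ is followed by $r-1$ change-free rounds and must output correctly for $G^i$ by the end of round $i+r-1$. The $r$-round bandwidth complexity is the minimum such $B$. $\textsc{MemList}(H)$: each node $v$ lists all subgraphs isomorphic to $H$ containing $v$. *)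

theory Defs
  imports "HOL-Library.Disjoint_Sets" "HOL-Library.Extended_Real"
begin

section \<open>Graphs\<close>

datatype 'a graph = Graph (verts: "'a set") (edges: "'a set set")

definition simple_graph :: "'a graph \<Rightarrow> bool" where
  "simple_graph G \<longleftrightarrow> finite (verts G) \<and> (\<forall>e\<in>edges G. e \<subseteq> verts G \<and> card e = 2)"

definition neighbors :: "'a graph \<Rightarrow> 'a \<Rightarrow> 'a set" where
  "neighbors G v = {u. {u, v} \<in> edges G}"

definition connected_graph :: "'a graph \<Rightarrow> bool" where
  "connected_graph G \<longleftrightarrow> verts G \<noteq> {} \<and>
     (\<forall>u\<in>verts G. \<forall>v\<in>verts G. (u, v) \<in> {(x, y). {x, y} \<in> edges G}\<^sup>*)"

text \<open>Since the two nodes below may lie in the same part, the equivalence also says that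
  each part is independent.\<close>

definition complete_multipartite :: "'a graph \<Rightarrow> bool" where
  "complete_multipartite G \<longleftrightarrow>
     (\<exists>P. partition_on (verts G) P \<and>
          (\<forall>u\<in>verts G. \<forall>v\<in>verts G. {u, v} \<in> edges G \<longleftrightarrow> \<not> (\<exists>p\<in>P. u \<in> p \<and> v \<in> p)))"

definition is_subgraph :: "'a graph \<Rightarrow> 'a graph \<Rightarrow> bool" where
  "is_subgraph K G \<longleftrightarrow> simple_graph K \<and> verts K \<subseteq> verts G \<and> edges K \<subseteq> edges G"

definition isomorphic :: "'a graph \<Rightarrow> 'b graph \<Rightarrow> bool" where
  "isomorphic G G' \<longleftrightarrow>
     (\<exists>f. bij_betw f (verts G) (verts G') \<and>
          (\<forall>u\<in>verts G. \<forall>v\<in>verts G. {u, v} \<in> edges G \<longleftrightarrow> {f u, f v} \<in> edges G'))"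

text \<open>The correct output of node \<open>v\<close> for \<open>MemList(H)\<close>; subgraphs need not be induced.\<close>

definition mem_list :: "'a graph \<Rightarrow> nat graph \<Rightarrow> nat \<Rightarrow> nat graph set" where
  "mem_list H G v = {K. is_subgraph K G \<and> isomorphic K H \<and> v \<in> verts K}"


section \<open>Dynamic networks under edge insertions\<close>

definition insertion_sequence :: "nat \<Rightarrow> (nat \<Rightarrow> nat graph) \<Rightarrow> bool" where
  "insertion_sequence n G \<longleftrightarrow>
     (\<forall>i. simple_graph (G i) \<and> verts (G i) = {1..n}) \<and>
     (\<forall>i. G (Suc i) = G i \<or> (\<exists>e. edges (G (Suc i)) = insert e (edges (G i))))"

definition change_at :: "(nat \<Rightarrow> nat graph) \<Rightarrow> nat \<Rightarrow> bool" where
  "change_at G i \<longleftrightarrow> i \<ge> 1 \<and> G i \<noteq> G (i - 1)"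

definition spaced_changes :: "nat \<Rightarrow> (nat \<Rightarrow> nat graph) \<Rightarrow> bool" where
  "spaced_changes r G \<longleftrightarrow>
     (\<forall>i. change_at G i \<longrightarrow> (\<forall>j\<in>{i + 1..i + r - 1}. \<not> change_at G j))"


section \<open>Deterministic algorithms\<close>

text \<open>What a node observes in one round: its neighbor set, and the message received from each
  neighbor (\<open>None\<close> for the other nodes).\<close>

type_synonym observation = "nat set \<times> (nat \<Rightarrow> bool list option)"

text \<open>Local computation is unrestricted, so the state of a node is, without loss of generality,
  everything it has seen: its ID, the initial graph and the observations of all past rounds, in
  chronological order. In addition, \<open>send\<close> depends on the sender's neighbor set in the current
  round and on the recipient's ID. The output is computed at the end of a round.\<close>

datatype algorithm = Algorithm
  (send: "nat \<Rightarrow> nat graph \<Rightarrow> observation list \<Rightarrow> nat set \<Rightarrow> nat \<Rightarrow> bool list")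
  (out: "nat \<Rightarrow> nat graph \<Rightarrow> observation list \<Rightarrow> nat graph set")

text \<open>\<open>history A G i v\<close>: the observations of node \<open>v\<close> in rounds \<open>1, \<dots>, i\<close>. Round \<open>i\<close> first changes
  \<open>G (i - 1)\<close> into \<open>G i\<close>; then messages are exchanged along the edges of \<open>G i\<close>.\<close>

primrec history :: "algorithm \<Rightarrow> (nat \<Rightarrow> nat graph) \<Rightarrow> nat \<Rightarrow> nat \<Rightarrow> observation list" where
  "history A G 0 v = []"
| "history A G (Suc i) v = history A G i v @
     [(neighbors (G (Suc i)) v,
       \<lambda>u. if u \<in> neighbors (G (Suc i)) v
           then Some (send A u (G 0) (history A G i u) (neighbors (G (Suc i)) u) v)
           else None)]"

definition has_bandwidth :: "algorithm \<Rightarrow> nat \<Rightarrow> bool" where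
  "has_bandwidth A B \<longleftrightarrow> (\<forall>v G0 h N u. length (send A v G0 h N u) = B)"

definition solves_mem_list :: "algorithm \<Rightarrow> 'a graph \<Rightarrow> nat \<Rightarrow> nat \<Rightarrow> bool" where
  "solves_mem_list A H n r \<longleftrightarrow>
     (\<forall>G. insertion_sequence n G \<and> spaced_changes r G \<longrightarrow>
        (\<forall>i. change_at G i \<longrightarrow>
           (\<forall>v\<in>{1..n}. out A v (G 0) (history A G (i + r - 1) v) = mem_list H (G i) v)))"

text \<open>The infimum of the empty set is \<open>\<infinity>\<close>. This case does occur: if \<open>r\<close> is small compared to the
  diameter of \<open>H\<close>, no bandwidth suffices. Otherwise the infimum is a minimum.\<close>

definition bandwidth_complexity :: "'a graph \<Rightarrow> nat \<Rightarrow> nat \<Rightarrow> enat" where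
  "bandwidth_complexity H n r =
     (INF B\<in>{B. \<exists>A. has_bandwidth A B \<and> solves_mem_list A H n r}. enat B)"

end

theory Submission
  imports Defs
begin

text \<open>Since \<open>H\<close> is not complete multipartite, it has an edge \<open>uw\<close> and a node \<open>v\<close> adjacent to
  neither \<open>u\<close> nor \<open>w\<close>. Replace \<open>u\<close> and \<open>w\<close> by \<open>m = \<Theta>(n)\<close> copies each, and start with \<open>v\<close> isolated
  and without the edges between the copies of \<open>u\<close> and those of \<open>w\<close>. First an arbitrary set \<open>S\<close> of
  the latter \<open>m\<^sup>2\<close> edges is inserted, then the at most \<open>|V(H)|\<close> edges at \<open>v\<close>. Every edge of \<open>S\<close>
  now lies in a copy of \<open>H\<close> through \<open>v\<close>, so the output of \<open>v\<close> determines \<open>S\<close>. But \<open>v\<close> is only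
  connected to other nodes during the last \<open>O(r)\<close> rounds and has \<open>O(1)\<close> neighbors, from which it
  receives \<open>O(r B)\<close> bits. Hence \<open>m\<^sup>2 = O(r B)\<close>.\<close>

section \<open>Nodes and edges of the pattern graph\<close>

text \<open>Non-adjacency is reflexive and symmetric on the nodes. Without such a triple it would
  also be transitive, and its classes would be the parts of a complete multipartite graph.\<close>

lemma not_complete_multipartiteE:
  assumes "simple_graph H" "\<not> complete_multipartite H"
  obtains u v w where "v \<in> verts H" "{u, w} \<in> edges H" "{u, v} \<notin> edges H" "{w, v} \<notin> edges H"
proof -
  define R where "R = {(x, y). x \<in> verts H \<and> y \<in> verts H \<and> {x, y} \<notin> edges H}"
  have "\<exists>u v w. v \<in> verts H \<and> {u, w} \<in> edges H \<and> {u, v} \<notin> edges H \<and> {w, v} \<notin> edges H"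
  proof (rule ccontr)
    assume *: "\<not> ?thesis"
    have "{x, x} \<notin> edges H" for x
      using assms(1) by (force simp: simple_graph_def)
    then have refl: "refl_on (verts H) R"
      by (auto simp: refl_on_def R_def)
    have sym: "sym R"
      by (auto simp: sym_def R_def insert_commute)
    have trans: "trans R"
      unfolding trans_def R_def using * by (auto simp: insert_commute)
    have equiv: "equiv (verts H) R"
      using refl sym trans by (auto simp: equiv_def R_def)
    have "{x, y} \<in> edges H \<longleftrightarrow> \<not> (\<exists>p\<in>verts H // R. x \<in> p \<and> y \<in> p)"
      if "x \<in> verts H" "y \<in> verts H" for x y
    proof -
      have "(\<exists>p\<in>verts H // R. x \<in> p \<and> y \<in> p) \<longleftrightarrow> (x, y) \<in> R"
        using that equiv quotient_eq_iff[OF equiv] by (meson equiv_class_self quotientI Image_singleton_iff)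
      with that show ?thesis by (simp add: R_def)
    qed
    with partition_on_quotient[OF equiv] have "complete_multipartite H"
      unfolding complete_multipartite_def by blast
    with assms(2) show False by simp
  qed
  with that show ?thesis by blast
qed

lemma connected_graph_neighborE:
  assumes "connected_graph H" "card (verts H) \<ge> 2" "v \<in> verts H"
  obtains a where "{a, v} \<in> edges H"
proof -
  have "verts H \<noteq> {v}" using assms(2) by auto
  then obtain b where b: "b \<in> verts H" "b \<noteq> v" using assms(3) by blast
  then have "(v, b) \<in> {(x, y). {x, y} \<in> edges H}\<^sup>*"
    using assms by (auto simp: connected_graph_def)
  then show ?thesis
    using b(2) that by (cases rule: converse_rtranclE) (auto simp: insert_commute)
qed


section \<open>Counting the bits that one node receives\<close>

text \<open>A history records only the neighbor sets of \<open>x\<close> and the messages sent to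
  \<open>x\<close>. The histories of the senders may differ as long as these messages agree.\<close>

lemma history_cong:
  assumes "G 0 = G' 0"
    and "\<And>i. i < T \<Longrightarrow> neighbors (G (Suc i)) x = neighbors (G' (Suc i)) x"
    and "\<And>i y. i < T \<Longrightarrow> y \<in> neighbors (G' (Suc i)) x \<Longrightarrow>
      send A y (G 0) (history A G i y) (neighbors (G (Suc i)) y) x =
      send A y (G' 0) (history A G' i y) (neighbors (G' (Suc i)) y) x"
  shows "history A G T x = history A G' T x"
  using assms(2,3)
proof (induction T)
  case (Suc T)
  then show ?case using assms(1) by (auto simp: fun_eq_iff)
qed simp

text \<open>All runs in \<open>I\<close> show \<open>x\<close> the same neighbor sets, so its
  history is a function of the messages alone. These come from \<open>N\<close>, have
  \<open>B\<close> bits each and arrive only after round \<open>T0\<close>.\<close>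

lemma card_le_received_messages:
  assumes "has_bandwidth A B"
    and "finite N"
    and G0: "\<And>s. s \<in> I \<Longrightarrow> G s 0 = G0"
    and nb: "\<And>s i. s \<in> I \<Longrightarrow> i < T \<Longrightarrow> neighbors (G s (Suc i)) x = nb i"
    and "\<And>i. i < T0 \<Longrightarrow> nb i = {}"
    and "\<And>i. nb i \<subseteq> N"
    and inj: "inj_on (\<lambda>s. history A (G s) T x) I"
  shows "card I \<le> 2 ^ (B * (card N * (T - T0)))"
proof -
  \<comment> \<open>This is what \<open>y\<close> would send to \<open>x\<close> in round
    \<open>i + 1\<close>, defined even if the two are not adjacent then. Such pairs in
    \<open>J\<close> only enlarge the count.\<close>
  define msg where "msg s = (\<lambda>(i, y).
    send A y (G s 0) (history A (G s) i y) (neighbors (G s (Suc i)) y) x)" for s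
  define J where "J = {T0..<T} \<times> N"
  define M where "M = {xs :: bool list. set xs \<subseteq> UNIV \<and> length xs = B}"
  have J: "finite J" "card J = card N * (T - T0)"
    using assms(2) by (auto simp: J_def card_cartesian_product)
  have M: "finite M" "card M = 2 ^ B"
    unfolding M_def by (rule finite_lists_length_eq, simp, subst card_lists_length_eq) auto
  have "inj_on (\<lambda>s. restrict (msg s) J) I"
  proof (rule inj_onI)
    fix s t assume st: "s \<in> I" "t \<in> I" and eq: "restrict (msg s) J = restrict (msg t) J"
    have eq': "msg s (i, y) = msg t (i, y)" if "i < T" "y \<in> nb i" for i y
    proof -
      have "(i, y) \<in> J"
        using that assms(5,6) by (force simp: J_def not_less[symmetric])
      then show ?thesis using eq by (metis restrict_apply)
    qed
    have "history A (G s) T x = history A (G t) T x"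
      using eq' by (intro history_cong) (auto simp: G0 nb st msg_def)
    with inj st show "s = t" by (auto dest: inj_onD)
  qed
  moreover have "(\<lambda>s. restrict (msg s) J) ` I \<subseteq> (\<Pi>\<^sub>E j\<in>J. M)"
    using assms(1) by (auto simp: msg_def M_def has_bandwidth_def)
  ultimately have "card I \<le> card (\<Pi>\<^sub>E j\<in>J. M)"
    using J(1) M(1) by (intro card_inj_on_le) (auto intro: finite_PiE)
  also have "\<dots> = 2 ^ (B * (card N * (T - T0)))"
    using J M by (simp add: card_PiE power_mult)
  finally show ?thesis .
qed


section \<open>Insertion schedules with \<open>r\<close> rounds per slot\<close>

text \<open>The edges \<open>es k\<close> are inserted in round \<open>k * r + 1\<close>.\<close>

definition schedule ::
  "nat \<Rightarrow> nat \<Rightarrow> nat set set \<Rightarrow> (nat \<Rightarrow> nat set set) \<Rightarrow> nat \<Rightarrow> nat graph" where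
  "schedule n r E es i = Graph {1..n} (E \<union> (\<Union>k\<in>{k. k * r < i}. es k))"

lemma schedule_0 [simp]: "schedule n r E es 0 = Graph {1..n} E"
  by (simp add: schedule_def)

lemma schedule_Suc_mult:
  assumes "r \<ge> 1"
  shows "edges (schedule n r E es (Suc (k * r))) = edges (schedule n r E es (k * r)) \<union> es k"
proof -
  have "{j. j * r < Suc (k * r)} = insert k {j. j * r < k * r}"
    using assms by (auto simp: less_Suc_eq)
  then show ?thesis by (auto simp: schedule_def)
qed

lemma schedule_Suc_eq:
  assumes "\<And>k. i \<noteq> k * r"
  shows "schedule n r E es (Suc i) = schedule n r E es i"
proof -
  have "{k. k * r < Suc i} = {k. k * r < i}"
    using assms by (metis less_Suc_eq)
  then show ?thesis by (simp add: schedule_def)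
qed

lemma insertion_sequence_schedule:
  assumes "r \<ge> 1"
    and "\<And>e. e \<in> E \<or> (\<exists>k. e \<in> es k) \<Longrightarrow> e \<subseteq> {1..n} \<and> card e = 2"
    and "\<And>k. es k = {} \<or> (\<exists>e. es k = {e})"
  shows "insertion_sequence n (schedule n r E es)"
  unfolding insertion_sequence_def
proof (intro conjI allI)
  fix i
  show "simple_graph (schedule n r E es i)" "verts (schedule n r E es i) = {1..n}"
    using assms(2) by (auto simp: simple_graph_def schedule_def)
  show "schedule n r E es (Suc i) = schedule n r E es i \<or>
    (\<exists>e. edges (schedule n r E es (Suc i)) = insert e (edges (schedule n r E es i)))"
  proof (cases "\<exists>k. i = k * r")
    case True
    then obtain k where "i = k * r" by blast
    then have "edges (schedule n r E es (Suc i)) = edges (schedule n r E es i) \<union> es k"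
      using assms(1) by (simp add: schedule_Suc_mult)
    with assms(3)[of k] show ?thesis
      by (intro graph.expand disjCI) (auto simp: schedule_def)
  next
    case False
    then show ?thesis by (simp add: schedule_Suc_eq)
  qed
qed

text \<open>Changes occur only in rounds of the form \<open>k * r + 1\<close>, and two distinct such
  rounds are at least \<open>r\<close> apart.\<close>

lemma spaced_changes_schedule: "spaced_changes r (schedule n r E es)"
proof -
  have change: "\<exists>k. i = Suc (k * r)" if "change_at (schedule n r E es) i" for i
    using that schedule_Suc_eq[of "i - 1" r n E es]
    by (cases i) (auto simp: change_at_def)
  have "\<not> change_at (schedule n r E es) j"
    if "change_at (schedule n r E es) i" "i < j" "j < i + r" for i j
  proof
    assume "change_at (schedule n r E es) j"
    then obtain k l where "i = Suc (k * r)" "j = Suc (l * r)"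
      using change \<open>change_at _ i\<close> by meson
    with that have "k * r < l * r" "l * r < Suc k * r" by auto
    then have "k < l" "l < Suc k" using mult_less_cancel2 by blast+
    then show False by simp
  qed
  then show ?thesis by (auto simp: spaced_changes_def)
qed


section \<open>Hidden edges cost bandwidth\<close>

text \<open>\<open>D\<close> is the set of edges that encode bits, \<open>E\<close> the initial edges, \<open>x\<close> the node that has to learn
  the bits after its star to \<open>N\<close> has been inserted.\<close>

lemma card_hidden_edges_le:
  assumes A: "has_bandwidth A B" "solves_mem_list A H n r" and r: "r \<ge> 1"
    and x: "x \<in> {1..n}"
    and N: "N \<subseteq> {1..n} - {x}" "N \<noteq> {}"
    and D: "finite D" "D \<inter> E = {}"
    and DE: "\<And>e. e \<in> D \<union> E \<Longrightarrow> e \<subseteq> {1..n} - {x} \<and> card e = 2"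
    and listed: "\<And>S e. S \<subseteq> D \<Longrightarrow> e \<in> S \<Longrightarrow>
      \<exists>K\<in>mem_list H (Graph {1..n} (E \<union> S \<union> (\<lambda>a. {a, x}) ` N)) x. e \<in> edges K"
  shows "card D \<le> B * (card N)\<^sup>2 * r"
proof -
  define M where "M = card D"
  define d where "d = card N"
  have "finite N" using N(1) finite_subset by blast
  then have "d \<ge> 1" using N(2) by (auto simp: d_def Suc_le_eq card_gt_0_iff)
  obtain dl where dl: "bij_betw dl {0..<M} D"
    using ex_bij_betw_nat_finite[OF D(1)] by (auto simp: M_def)
  obtain nl where nl: "bij_betw nl {0..<d} N"
    using ex_bij_betw_nat_finite[OF \<open>finite N\<close>] by (auto simp: d_def)
  have dl_D: "dl k \<in> D" if "k < M" for k
    using dl that by (auto simp: bij_betw_def)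
  have nl_N: "nl k \<in> N" if "k < d" for k
    using nl that by (auto simp: bij_betw_def)
  \<comment> \<open>Every edge of \<open>D\<close> keeps its own slot, which stays idle if the edge
    is not in \<open>S\<close>. So the star is inserted in the same rounds for all \<open>S\<close>,
    and the timing reveals nothing to \<open>x\<close>.\<close>
  define es where "es S k = (if k < M then {dl k} \<inter> S
    else if k < M + d then {{nl (k - M), x}} else {})" for S k
  define G where "G S = schedule n r E (es S)" for S
  define T where "T = (M + d) * r"
  have less_T: "{k. k * r < T} = {0..<M + d}"
    using r by (auto simp: T_def)
  have es_range: "e \<in> D \<or> (\<exists>a\<in>N. e = {a, x})" if "e \<in> es S k" for e S k
    using that dl_D nl_N[of "k - M"] by (auto simp: es_def split: if_splits)
  have final: "G S T = Graph {1..n} (E \<union> S \<union> (\<lambda>a. {a, x}) ` N)" if "S \<subseteq> D" for S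
  proof -
    have "(\<Union>k\<in>{0..<M + d}. es S k) = (\<Union>k\<in>{0..<M}. es S k) \<union> (\<Union>k\<in>(+) M ` {0..<d}. es S k)"
      by (simp only: UN_Un[symmetric] image_add_atLeastLessThan) (simp add: ivl_disj_un add.commute)
    also have "(\<Union>k\<in>{0..<M}. es S k) = dl ` {0..<M} \<inter> S"
      by (auto simp: es_def)
    also have "(\<Union>k\<in>(+) M ` {0..<d}. es S k) = (\<lambda>a. {a, x}) ` nl ` {0..<d}"
      unfolding image_image by (simp add: es_def del: image_add_atLeastLessThan) blast
    finally show ?thesis
      using dl nl that by (auto simp: G_def schedule_def less_T bij_betw_def)
  qed
  have seq: "insertion_sequence n (G S)" for S
    unfolding G_def
  proof (rule insertion_sequence_schedule[OF r])
    fix e assume "e \<in> E \<or> (\<exists>k. e \<in> es S k)"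
    then have "e \<in> D \<union> E \<or> (\<exists>a\<in>N. e = {a, x})" using es_range by blast
    then show "e \<subseteq> {1..n} \<and> card e = 2"
    proof
      assume "\<exists>a\<in>N. e = {a, x}"
      then obtain a where "a \<in> N" "e = {a, x}" by blast
      moreover from this have "a \<in> {1..n}" "a \<noteq> x" using N(1) by auto
      ultimately show ?thesis using x by auto
    qed (use DE in blast)
  qed (auto simp: es_def)
  \<comment> \<open>The round of the last star edge; the output for it is due at the end of round
    \<open>T\<close>.\<close>
  define i where "i = Suc ((M + d - 1) * r)"
  have iT: "i + r - 1 = T"
    using \<open>d \<ge> 1\<close> by (cases d) (auto simp: i_def T_def)
  have steps: "{k. k * r < i} = {0..<M + d}"
    using r \<open>d \<ge> 1\<close> by (auto simp: i_def less_Suc_eq_le)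
  have Gi: "G S i = G S T" for S
    by (simp add: G_def schedule_def steps less_T)
  \<comment> \<open>Correctness is only demanded after an actual change. The last star edge is new
    for every \<open>S\<close>, even the empty one.\<close>
  have change: "change_at (G S) i" if "S \<subseteq> D" for S
  proof -
    let ?e = "{nl (d - 1), x}"
    have "?e \<notin> es S k" if k: "k < M + d - 1" for k
    proof
      assume *: "?e \<in> es S k"
      show False
      proof (cases "k < M")
        case True
        then have "?e \<in> D" using * dl_D by (auto simp: es_def)
        then show False using DE by blast
      next
        case False
        then have "?e = {nl (k - M), x}"
          using * k by (auto simp only: es_def split: if_splits)
        then have "nl (k - M) = nl (d - 1)" by (auto simp: doubleton_eq_iff)
        then have "k - M = d - 1"
          using nl k False by (auto simp: bij_betw_def dest!: inj_onD)
        then show False using k False by simp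
      qed
    qed
    moreover have "?e \<notin> E" using DE by blast
    ultimately have "?e \<notin> edges (G S (i - 1))"
      using r by (auto simp: G_def schedule_def i_def)
    moreover have "?e \<in> edges (G S i)"
      using final[OF \<open>S \<subseteq> D\<close>] nl_N[of "d - 1"] \<open>d \<ge> 1\<close> by (auto simp: Gi)
    ultimately show ?thesis by (auto simp: change_at_def i_def)
  qed
  have mem: "mem_list H (G S T) x = out A x (G S 0) (history A (G S) T x)" if "S \<subseteq> D" for S
    using A(2) seq spaced_changes_schedule change[OF that] x iT Gi[of S]
    unfolding solves_mem_list_def G_def by metis
  have inj: "inj_on (\<lambda>S. history A (G S) T x) (Pow D)"
  proof (rule inj_onI)
    fix S S' assume S: "S \<in> Pow D" "S' \<in> Pow D"
      and "history A (G S) T x = history A (G S') T x"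
    then have eq: "mem_list H (G S T) x = mem_list H (G S' T) x"
      using mem[of S] mem[of S'] by (simp add: G_def)
    \<comment> \<open>Each edge of \<open>P\<close> lies in a listed subgraph, which by equality of
      the outputs is also a subgraph of \<open>G P' T\<close>. There the only edges from
      \<open>D\<close> are those of \<open>P'\<close>. Exchanging the two sets gives
      equality.\<close>
    have "P \<subseteq> P'" if PP': "P \<subseteq> D" "P' \<subseteq> D" "mem_list H (G P T) x = mem_list H (G P' T) x" for P P'
    proof
      fix e assume "e \<in> P"
      then obtain K where "K \<in> mem_list H (G P T) x" "e \<in> edges K"
        using listed[OF PP'(1)] final[OF PP'(1)] by metis
      then have "e \<in> edges (G P' T)"
        using PP'(3) by (auto simp: mem_list_def is_subgraph_def)
      then have "e \<in> E \<union> P' \<union> (\<lambda>a. {a, x}) ` N"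
        using final[OF PP'(2)] by simp
      moreover have "e \<in> D" using PP' \<open>e \<in> P\<close> by blast
      ultimately show "e \<in> P'" using DE[of e] D(2) by auto
    qed
    then show "S = S'" using S eq by (metis PowD subset_antisym)
  qed
  define nb where "nb j = {y. \<exists>k. k * r < Suc j \<and> M \<le> k \<and> k < M + d \<and> y = nl (k - M)}" for j
  have nb_G: "neighbors (G S (Suc j)) x = nb j" if "S \<in> Pow D" for S j
  proof -
    have "{y, x} \<in> es S k \<longleftrightarrow> M \<le> k \<and> k < M + d \<and> y = nl (k - M)" for y k
      using dl_D[of k] DE[of "dl k"] by (auto simp: es_def doubleton_eq_iff)
    moreover have "{y, x} \<notin> E" for y using DE by blast
    ultimately show ?thesis
      by (auto simp: neighbors_def G_def schedule_def nb_def)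
  qed
  have nb_empty: "nb j = {}" if "j < M * r" for j
  proof -
    have False if "k * r < Suc j" "M \<le> k" for k
      using \<open>j < M * r\<close> that mult_le_mono1[of M k r] by linarith
    then show ?thesis by (auto simp: nb_def)
  qed
  have nb_N: "nb j \<subseteq> N" for j
    using nl_N by (auto simp: nb_def)
  \<comment> \<open>There are \<open>2 ^ M\<close> choices of \<open>S\<close>, and \<open>x\<close>
    has neighbors only during the last \<open>T - M * r = d * r\<close> rounds.\<close>
  have "card (Pow D) \<le> 2 ^ (B * (card N * (T - M * r)))"
    by (rule card_le_received_messages[OF A(1) \<open>finite N\<close> _ nb_G nb_empty nb_N inj])
      (simp_all add: G_def)
  then have "M \<le> B * (d * (T - M * r))"
    by (simp add: card_Pow D(1) M_def d_def)
  then show ?thesis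
    by (simp add: T_def M_def d_def algebra_simps power2_eq_square)
qed


section \<open>Hiding a complete bipartite graph in a blow-up of \<open>H\<close>\<close>

lemma card_star_copies_le:
  fixes H :: "'a graph"
  assumes H: "simple_graph H" "connected_graph H" "card (verts H) \<ge> 3"
    and uvw: "v \<in> verts H" "{u, w} \<in> edges H" "{u, v} \<notin> edges H" "{w, v} \<notin> edges H"
    and A: "has_bandwidth A B" "solves_mem_list A H n r" and r: "r \<ge> 1"
    and n: "card (verts H) + 2 * m \<le> n"
  shows "m\<^sup>2 \<le> B * (card (verts H))\<^sup>2 * r"
proof -
  define h where "h = card (verts H)"
  have edgeD: "a \<in> verts H" "b \<in> verts H" "a \<noteq> b" if "{a, b} \<in> edges H" for a b
    using that H(1) by (auto simp: simple_graph_def card_insert_if split: if_splits)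
  have "u \<noteq> v" "w \<noteq> v" "u \<noteq> w"
    using uvw edgeD(3)[of u w] by (auto simp: insert_commute)
  have "finite (verts H)" using H(1) by (simp add: simple_graph_def)
  then obtain g where g: "bij_betw g {1..h} (verts H)"
    using ex_bij_betw_nat_finite_1 h_def by metis
  \<comment> \<open>The map \<open>f\<close> sends a network node to the node of \<open>H\<close>
    that it copies. Nodes up to \<open>h\<close> form the original copy; surplus nodes above
    \<open>h + 2 * m\<close> act as copies of \<open>w\<close> outside \<open>W\<close>.\<close>
  define f where "f k = (if k \<le> h then g k else if k \<le> h + m then u else w)" for k
  define U where "U = {h + 1..h + m}"
  define W where "W = {h + m + 1..h + 2 * m}"
  obtain x where x: "x \<in> {1..h}" "g x = v"
    using bij_betw_imp_surj_on[OF g] uvw(1) by (metis imageE)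
  have f_le: "f k = g k" if "k \<in> {1..h}" for k
    using that by (simp add: f_def)
  have f_U: "f k = u" if "k \<in> U" for k
    using that by (simp add: f_def U_def)
  have f_W: "f k = w" if "k \<in> W" for k
    using that by (simp add: f_def W_def)
  have fx: "f x = v" using x f_le by simp
  have hn: "h + 2 * m \<le> n" using n by (simp add: h_def)
  define F where "F = {{a, b} | a b. a \<in> {1..n} \<and> b \<in> {1..n} \<and> {f a, f b} \<in> edges H}"
  define D where "D = (\<lambda>(a, b). {a, b}) ` (U \<times> W)"
  define E where "E = {e \<in> F. x \<notin> e \<and> e \<notin> D}"
  define N where "N = {a \<in> {1..h}. {g a, v} \<in> edges H}"
  have "inj_on (\<lambda>(a, b). {a, b}) (U \<times> W)"
    by (auto simp: inj_on_def U_def W_def doubleton_eq_iff)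
  then have cardD: "card D = m\<^sup>2"
    by (simp add: D_def card_image card_cartesian_product U_def W_def power2_eq_square)
  have x_UW: "x \<notin> U" "x \<notin> W" using x by (auto simp: U_def W_def)
  have UWn: "U \<subseteq> {1..n}" "W \<subseteq> {1..n}" "U \<inter> W = {}" using hn by (auto simp: U_def W_def)
  have N_x: "x \<notin> N" using edgeD(3)[of "g x" v] x by (auto simp: N_def)
  have F_card: "e \<subseteq> {1..n} \<and> card e = 2" if "e \<in> F" for e
  proof -
    obtain a b where ab: "e = {a, b}" "a \<in> {1..n}" "b \<in> {1..n}" "{f a, f b} \<in> edges H"
      using \<open>e \<in> F\<close> by (auto simp: F_def)
    then have "a \<noteq> b" using edgeD(3) by metis
    with ab show ?thesis by auto
  qed
  have "card D \<le> B * (card N)\<^sup>2 * r"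
  proof (rule card_hidden_edges_le[OF A r, where x = x and E = E])
    show "x \<in> {1..n}" using x(1) hn by auto
    show "N \<subseteq> {1..n} - {x}" using N_x hn by (auto simp: N_def)
    show "N \<noteq> {}"
    proof -
      have "card (verts H) \<ge> 2" using H(3) by simp
      then obtain a where a: "{a, v} \<in> edges H"
        using connected_graph_neighborE[OF H(2) _ uvw(1)] by blast
      then have "a \<in> g ` {1..h}" using edgeD(1) g by (auto simp: bij_betw_def)
      with a show ?thesis by (auto simp: N_def)
    qed
    show "finite D" by (auto simp: D_def U_def W_def)
    show "D \<inter> E = {}" by (auto simp: E_def)
    show "e \<subseteq> {1..n} - {x} \<and> card e = 2" if "e \<in> D \<union> E" for e
      using that
    proof
      assume "e \<in> D"
      then obtain a b where ab: "a \<in> U" "b \<in> W" "e = {a, b}" by (auto simp: D_def)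
      then have "a \<noteq> b" using UWn by auto
      with ab x_UW UWn show ?thesis by auto
    next
      assume "e \<in> E"
      then show ?thesis using F_card[of e] by (auto simp: E_def)
    qed
    fix S e assume S: "S \<subseteq> D" "e \<in> S"
    let ?G = "Graph {1..n} (E \<union> S \<union> (\<lambda>a. {a, x}) ` N)"
    from S obtain a b where ab: "a \<in> U" "b \<in> W" "e = {a, b}" by (auto simp: D_def)
    \<comment> \<open>In the original copy, \<open>u\<close> and \<open>w\<close> are replaced by
      the endpoints \<open>a\<close> and \<open>b\<close> of the hidden edge. The node
      \<open>x\<close> survives because \<open>v\<close> differs from \<open>u\<close> and
      \<open>w\<close>.\<close>
    define C where "C = {k \<in> {1..h}. g k \<noteq> u \<and> g k \<noteq> w}"
    define V where "V = insert a (insert b C)"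
    define K where "K = Graph V {{c, d} | c d. c \<in> V \<and> d \<in> V \<and> {f c, f d} \<in> edges H}"
    have Vn: "V \<subseteq> {1..n}" using ab UWn hn by (auto simp: V_def C_def)
    have bij: "bij_betw f V (verts H)"
    proof -
      have "g ` C = g ` {1..h} - {u, w}"
        by (auto simp: C_def)
      then have "g ` C = verts H - {u, w}"
        using bij_betw_imp_surj_on[OF g] by simp
      then have "bij_betw g C (verts H - {u, w})"
        by (intro bij_betw_subset[OF g]) (auto simp: C_def)
      then have "bij_betw f C (verts H - {u, w})"
        by (rule bij_betw_cong[THEN iffD1, rotated]) (simp add: f_le C_def)
      moreover have "bij_betw f {a, b} {u, w}"
        using ab f_U f_W \<open>u \<noteq> w\<close> by (auto simp: bij_betw_def)
      ultimately have "bij_betw f (C \<union> {a, b}) ((verts H - {u, w}) \<union> {u, w})"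
        by (rule bij_betw_combine) auto
      moreover have "C \<union> {a, b} = V" by (auto simp: V_def)
      moreover have "(verts H - {u, w}) \<union> {u, w} = verts H" using edgeD[OF uvw(2)] by auto
      ultimately show ?thesis by simp
    qed
    have iso: "isomorphic K H"
      unfolding isomorphic_def
    proof (intro exI[of _ f] conjI ballI)
      show "bij_betw f (verts K) (verts H)" using bij by (simp add: K_def)
      show "{c, d} \<in> edges K \<longleftrightarrow> {f c, f d} \<in> edges H" if "c \<in> verts K" "d \<in> verts K" for c d
        using that by (auto simp: K_def doubleton_eq_iff insert_commute)
    qed
    have K_edge: "{c, d} \<in> edges ?G" if cd: "c \<in> V" "d \<in> V" "{f c, f d} \<in> edges H" for c d
    proof (cases "{c, d} \<in> D")
      case True
      \<comment> \<open>The only pair of \<open>D\<close> inside \<open>V\<close> is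
        \<open>e\<close> itself, so no other hidden edge is required for this copy of
        \<open>H\<close>.\<close>
      have "V \<inter> U = {a}" "V \<inter> W = {b}"
        using ab UWn(3) by (auto simp: V_def C_def U_def W_def)
      with True cd have "{c, d} = e" by (auto simp: D_def ab doubleton_eq_iff)
      then show ?thesis using S by simp
    next
      case False
      have star: "{k, x} \<in> (\<lambda>a. {a, x}) ` N" if "k \<in> V" "{f k, v} \<in> edges H" for k
      proof -
        have "k \<noteq> a" "k \<noteq> b" using that uvw f_U f_W ab by auto
        then have "k \<in> N" using that by (auto simp: V_def C_def N_def f_le)
        then show ?thesis by blast
      qed
      have "{c, d} \<in> F" unfolding F_def using cd Vn by blast
      moreover have "{c, d} \<in> (\<lambda>a. {a, x}) ` N" if "x \<in> {c, d}"
        using that star[of c] star[of d] cd fx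
        by (auto simp only: insert_commute insert_iff empty_iff)
      ultimately show ?thesis using False by (simp only: E_def graph.sel) blast
    qed
    have "edges K \<subseteq> F" unfolding K_def F_def graph.sel using Vn by blast
    then have "simple_graph K"
      using F_card Vn finite_subset[OF Vn] by (auto simp: simple_graph_def K_def)
    moreover have "edges K \<subseteq> edges ?G" using K_edge unfolding K_def graph.sel by blast
    ultimately have "is_subgraph K ?G" using Vn by (auto simp: is_subgraph_def K_def)
    moreover have "x \<in> verts K"
      using x \<open>u \<noteq> v\<close> \<open>w \<noteq> v\<close> by (auto simp: K_def V_def C_def)
    ultimately have "K \<in> mem_list H ?G x" using iso by (simp add: mem_list_def)
    moreover have "{f a, f b} \<in> edges H" using ab f_U f_W uvw(2) by simp
    then have "e \<in> edges K" unfolding K_def V_def graph.sel ab(3) by blast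
    ultimately show "\<exists>K\<in>mem_list H ?G x. e \<in> edges K" by blast
  qed
  moreover have "card N \<le> h"
  proof -
    have "N \<subseteq> {1..h}" by (auto simp: N_def)
    then show ?thesis using card_mono[of "{1..h}" N] by simp
  qed
  then have "B * (card N)\<^sup>2 * r \<le> B * h\<^sup>2 * r" by (simp add: power_mono)
  ultimately show ?thesis unfolding cardD h_def by (rule le_trans)
qed

section \<open>The asymptotic bound\<close>

theorem theorem5p7:
  fixes H :: "'a graph"
  assumes "simple_graph H"
    and "connected_graph H"
    and "card (verts H) \<ge> 3"
    and "\<not> complete_multipartite H"
  shows "\<exists>c::real. c > 0 \<and> (\<exists>n0::nat. \<forall>n\<ge>n0. \<forall>r\<ge>1.
           ereal (c * (real n)\<^sup>2 / real r) \<le> ereal_of_enat (bandwidth_complexity H n r))"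
proof -
  obtain u v w where uvw: "v \<in> verts H" "{u, w} \<in> edges H" "{u, v} \<notin> edges H" "{w, v} \<notin> edges H"
    using not_complete_multipartiteE[OF assms(1,4)] by blast
  define h where "h = card (verts H)"
  \<comment> \<open>The factor 64 is the square of 8 from \<open>n / 8 \<le> m\<close>; the factor
    \<open>h\<close> squared bounds the square of the star size.\<close>
  define c where "c = 1 / (64 * (real h)\<^sup>2)"
  have "h \<ge> 3" using assms(3) by (simp add: h_def)
  have "ereal (c * (real n)\<^sup>2 / real r) \<le> ereal_of_enat (bandwidth_complexity H n r)"
    if n: "n \<ge> 8 * h" and r: "r \<ge> 1" for n r
  proof -
    let ?X = "{B. \<exists>A. has_bandwidth A B \<and> solves_mem_list A H n r}"
    have bound: "c * (real n)\<^sup>2 / real r \<le> real B" if "B \<in> ?X" for B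
    proof -
      \<comment> \<open>A quarter of the nodes for each of \<open>U\<close> and \<open>W\<close>
        leaves at least half of them, hence enough for the original copy.\<close>
      define m where "m = n div 4"
      have "h + 2 * m \<le> n" using n by (simp add: m_def)
      then have "m\<^sup>2 \<le> B * h\<^sup>2 * r"
        using that card_star_copies_le[OF assms(1-3) uvw _ _ r] by (auto simp: h_def)
      then have "(real m)\<^sup>2 \<le> real B * (real h)\<^sup>2 * real r"
        by (metis of_nat_le_iff of_nat_mult of_nat_power)
      moreover have "real n / 8 \<le> real m"
        using n \<open>h \<ge> 3\<close> by (simp add: m_def)
      then have "(real n / 8)\<^sup>2 \<le> (real m)\<^sup>2" by (intro power_mono) auto
      ultimately show ?thesis
        using \<open>h \<ge> 3\<close> r by (simp add: c_def field_simps)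
    qed
    show ?thesis
    proof (cases "?X = {}")
      case True
      then have "bandwidth_complexity H n r = \<infinity>"
        unfolding bandwidth_complexity_def True by (simp add: Inf_enat_def)
      then show ?thesis by simp
    next
      case False
      \<comment> \<open>Since \<open>enat\<close> is well-ordered, the infimum is attained, and the
        bound for the minimizer suffices.\<close>
      then obtain B0 where "enat B0 \<in> enat ` ?X" by blast
      then have "Inf (enat ` ?X) \<in> enat ` ?X" by (rule wellorder_InfI)
      then obtain B where B: "B \<in> ?X" "Inf (enat ` ?X) = enat B" by (rule imageE) blast
      show ?thesis
        using bound[OF B(1)] by (simp only: bandwidth_complexity_def B(2) ereal_of_enat_simps
          ereal_less_eq)
    qed
  qed
  moreover have "c > 0" using \<open>h \<ge> 3\<close> by (simp add: c_def)
  ultimately show ?thesis by blast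
qed

end
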